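(* Let $k>0$ be real, let $\alpha,\beta,\beta',\gamma,\gamma'\in\mathbb{C}$ with $\gamma,\gamma'\notin\{0,-k,-2k,\dots\}$, and let $x,y\in\mathbb{C}$ with $|x|+|y|<\frac1k$. (i) If $\left|\frac{x}{1-kx}\right|+\left|\frac{y}{1-kx}\right|<\frac1k$, then $$F_{2,k}(\alpha,\beta,\beta';\gamma,\gamma';x,y)=(1-kx)^{-\frac{\alpha}{k}}F_{2,k}\left(\alpha,\gamma-\beta,\beta';\gamma,\gamma';-\frac{x}{1-kx},\frac{y}{1-kx}\right).$$ (ii) If $\left|\frac{x}{1-ky}\right|+\left|\frac{y}{1-ky}\right|<\frac1k$, then $$F_{2,k}(\alpha,\beta,\beta';\gamma,\gamma';x,y)=(1-ky)^{-\frac{\alpha}{k}}F_{2,k}\left(\alpha,\beta,\gamma'-\beta';\gamma,\gamma';\frac{x}{1-ky},-\frac{y}{1-ky}\right).$$ (iii) If $\left|\frac{x}{1-kx-ky}\right|+\left|\frac{y}{1-kx-ky}\right|<\frac1k$, then $$F_{2,k}(\alpha,\beta,\beta';\gamma,\gamma';x,y)=(1-kx-ky)^{-\frac{\alpha}{k}}F_{2,k}\left(\alpha,\gamma-\beta,\gamma'-\beta';\gamma,\gamma';-\frac{x}{1-kx-ky},-\frac{y}{1-kx-ky}\right).$$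
   Context: For real $k>0$, $a\in\mathbb{C}$ and an integer $n\ge 1$, the Pochhammer $k$-symbol is $(a)_{n,k}=a(a+k)(a+2k)\cdots(a+(n-1)k)$, and $(a)_{0,k}=1$. The second Appell $k$-function is $$F_{2,k}(\alpha,\beta,\beta';\gamma,\gamma';x,y)=\sum_{m,n=0}^\infty\frac{(\alpha)_{m+n,k}(\beta)_{m,k}(\beta')_{n,k}}{(\gamma)_{m,k}(\gamma')_{n,k}}\frac{x^m}{m!}\frac{y^n}{n!},\qquad |x|+|y|<\tfrac1k.$$ Complex powers are principal values. *)

theory Defs
  imports "HOL-Analysis.Analysis"
begin

definition pochhammer_k :: "real \<Rightarrow> complex \<Rightarrow> nat \<Rightarrow> complex" where
  "pochhammer_k k a n = (\<Prod>i<n. a + of_nat i * of_real k)"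

text \<open>
  The double series is an unconditional sum over all pairs of indices. It converges
  absolutely for \<open>norm x + norm y < 1 / k\<close> (provided that \<open>\<gamma>\<close> and \<open>\<gamma>'\<close> are not
  nonpositive integer multiples of \<open>k\<close>); outside the domain of summability the value
  is the default \<open>0\<close> of \<^const>\<open>infsum\<close> and carries no meaning.
\<close>
definition appell_F2_k ::
  "real \<Rightarrow> complex \<Rightarrow> complex \<Rightarrow> complex \<Rightarrow> complex \<Rightarrow> complex \<Rightarrow> complex \<Rightarrow> complex \<Rightarrow> complex"
where
  "appell_F2_k k \<alpha> \<beta> \<beta>' \<gamma> \<gamma>' x y =
     (\<Sum>\<^sub>\<infinity>(m, n)\<in>UNIV.
        pochhammer_k k \<alpha> (m + n) * pochhammer_k k \<beta> m * pochhammer_k k \<beta>' n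
          / (pochhammer_k k \<gamma> m * pochhammer_k k \<gamma>' n)
          * (x ^ m / fact m) * (y ^ n / fact n))"

end

theory Submission
  imports Defs "HOL-Complex_Analysis.Conformal_Mappings"
begin

text \<open>
  Replacing \<open>x, y\<close> by \<open>k x, k y\<close> and dividing all parameters by \<open>k\<close> removes \<open>k\<close>, so let
  \<open>k = 1\<close>. Put \<open>u\<^sub>m = (b)\<^sub>m x\<^sup>m / (c)\<^sub>m\<close> and \<open>v\<^sub>n = (b')\<^sub>n y\<^sup>n / (c')\<^sub>n\<close>. Summing the double
  series along antidiagonals gives
  \<open>F\<^sub>2 = \<Sum>\<^sub>N (a)\<^sub>N p\<^sub>N / N!\<close>, where \<open>p\<^sub>N = \<Sum>\<^sub>m (N choose m) u\<^sub>m v\<^bsub>N-m\<^esub>\<close>; in umbral notation this is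
  \<open>(1 - p)\<^bsup>-a\<^esup>\<close> with \<open>p\<^sup>N\<close> read as \<open>p\<^sub>N\<close>. The three assertions are then one: if \<open>p = z + q\<close>
  umbrally, then \<open>(1 - p)\<^bsup>-a\<^esup> = (1 - z)\<^bsup>-a\<^esup> (1 - q / (1 - z))\<^bsup>-a\<^esup>\<close>
  (lemma \<open>umbral_shift\<close>).

  The umbral relation \<open>p = z + q\<close> is expressed by exponential generating functions, which
  turn binomial convolution into multiplication: \<open>egf p = exp(z t) egf q\<close>. For the sequence \<open>u\<close>
  the function \<open>egf u\<close> is the confluent series \<open>\<^sub>1F\<^sub>1(b; c; x t)\<close>, and Kummer's first transformation
  \<open>\<^sub>1F\<^sub>1(b; c; x t) = exp(x t) \<^sub>1F\<^sub>1(c - b; c; - x t)\<close>, which is the Chu-Vandermonde identity, splits off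
  the factor \<open>exp(x t)\<close>. Applying it to \<open>u\<close>, to \<open>v\<close>, or to both gives the relation with
  \<open>z = x\<close>, \<open>z = y\<close> and \<open>z = x + y\<close>, hence (i), (ii) and (iii).

  The analytic content lies in the shift. Rearranging the series for
  \<open>(1 - z)\<^bsup>-a\<^esup> (1 - q / (1 - z))\<^bsup>-a\<^esup>\<close> needs absolute convergence, which the
  hypotheses do not give: it would require \<open>\<bar>z\<bar> + \<bar>x\<bar> + \<bar>y\<bar> < 1\<close>. Therefore \<open>z, x, y\<close> are scaled by
  a complex parameter \<open>t\<close>. Near \<open>t = 0\<close> the rearrangement is legitimate, and both sides are
  holomorphic in \<open>t\<close> where \<open>\<bar>t z\<bar> < 1\<close> and \<open>\<bar>t\<bar> (\<bar>x\<bar> + \<bar>y\<bar>)\<close> is less than \<open>1\<close> and than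
  \<open>\<bar>1 - t z\<bar>\<close>. This region is star-shaped about \<open>0\<close> and contains \<open>t = 1\<close>, so the identity theorem
  carries the equation there.
\<close>

section \<open>Exponential generating functions and binomial convolution\<close>

definition egf :: "(nat \<Rightarrow> complex) \<Rightarrow> complex fps" where
  "egf p = Abs_fps (\<lambda>n. p n / fact n)"

text \<open>
  The binomial series of \<open>(1 - p)\<^bsup>-a\<^esup>\<close> in which the power \<open>p\<^sup>n\<close> is replaced by the sequence entry
  \<open>p n\<close>.
\<close>
definition umbral :: "complex \<Rightarrow> (nat \<Rightarrow> complex) \<Rightarrow> complex" where
  "umbral a p = (\<Sum>n. pochhammer a n / fact n * p n)"

lemma egf_mult_nth:
  assumes "egf p = egf u * egf v"
  shows "p n / fact n = (\<Sum>m\<le>n. (u m / fact m) * (v (n - m) / fact (n - m)))"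
    and "p n = (\<Sum>m\<le>n. of_nat (n choose m) * u m * v (n - m))"
proof -
  have "fps_nth (egf p) n = fps_nth (egf u * egf v) n" using assms by simp
  then show 1: "p n / fact n = (\<Sum>m\<le>n. (u m / fact m) * (v (n - m) / fact (n - m)))"
    by (simp add: egf_def fps_mult_nth atLeast0AtMost)
  have "p n = fact n * (p n / fact n)" by simp
  also have "\<dots> = (\<Sum>m\<le>n. of_nat (n choose m) * u m * v (n - m))"
    unfolding 1 sum_distrib_left
    by (intro sum.cong refl) (simp add: binomial_fact field_simps)
  finally show "p n = (\<Sum>m\<le>n. of_nat (n choose m) * u m * v (n - m))" .
qed

lemma egf_powers: "egf (\<lambda>n. z ^ n) = fps_exp z"
  by (rule fps_ext) (simp add: egf_def)

lemma egf_mult_scale: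
  assumes "egf p = egf u * egf v"
  shows "egf (\<lambda>n. p n * t ^ n) = egf (\<lambda>n. u n * t ^ n) * egf (\<lambda>n. v n * t ^ n)"
proof (rule fps_ext)
  fix n
  have "fps_nth (egf (\<lambda>n. p n * t ^ n)) n =
     (\<Sum>m\<le>n. (u m / fact m) * (v (n - m) / fact (n - m))) * t ^ n"
    using egf_mult_nth(1)[OF assms, of n] by (simp add: egf_def flip: times_divide_eq_left)
  also have "\<dots> = (\<Sum>m\<le>n. ((u m * t ^ m) / fact m) * ((v (n - m) * t ^ (n - m)) / fact (n - m)))"
    unfolding sum_distrib_right
  proof (intro sum.cong refl)
    fix m assume "m \<in> {..n}"
    then have "t ^ n = t ^ m * t ^ (n - m)" by (simp flip: power_add)
    then show "u m / fact m * (v (n - m) / fact (n - m)) * t ^ n =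
        ((u m * t ^ m) / fact m) * ((v (n - m) * t ^ (n - m)) / fact (n - m))" by simp
  qed
  also have "\<dots> = fps_nth (egf (\<lambda>n. u n * t ^ n) * egf (\<lambda>n. v n * t ^ n)) n"
    by (simp add: egf_def fps_mult_nth atLeast0AtMost)
  finally show "fps_nth (egf (\<lambda>n. p n * t ^ n)) n = \<dots>" .
qed

text \<open>
  Growth rates add under binomial convolution, by the binomial theorem. The bound on the sum of
  norms is the stronger one that absolute convergence of the double series needs.
\<close>
lemma egf_mult_growth:
  assumes p: "egf p = egf u * egf v"
    and u: "\<And>n. norm (u n) \<le> K * R ^ n" and v: "\<And>n. norm (v n) \<le> L * S ^ n"
    and "R \<ge> 0" "S \<ge> 0"
  shows "(\<Sum>m\<le>n. of_nat (n choose m) * norm (u m) * norm (v (n - m))) \<le> K * L * (R + S) ^ n"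
    and "norm (p n) \<le> K * L * (R + S) ^ n"
proof -
  have K: "K \<ge> 0" using order_trans[OF norm_ge_zero u[of 0]] by simp
  have "norm (u m) * norm (v (n - m)) \<le> (K * R ^ m) * (L * S ^ (n - m))" for m
    by (intro mult_mono u v) (use K assms in auto)
  then have "(\<Sum>m\<le>n. of_nat (n choose m) * norm (u m) * norm (v (n - m))) \<le>
      (\<Sum>m\<le>n. of_nat (n choose m) * ((K * R ^ m) * (L * S ^ (n - m))))"
    by (intro sum_mono) (simp add: mult.assoc mult_left_mono)
  also have "\<dots> = K * L * (R + S) ^ n"
    by (simp add: binomial_ring sum_distrib_left mult_ac)
  finally show 1: "(\<Sum>m\<le>n. of_nat (n choose m) * norm (u m) * norm (v (n - m))) \<le> K * L * (R + S) ^ n" .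
  have "norm (p n) \<le> (\<Sum>m\<le>n. of_nat (n choose m) * norm (u m) * norm (v (n - m)))"
    unfolding egf_mult_nth(2)[OF p] by (rule order_trans[OF norm_sum]) (simp add: norm_mult)
  with 1 show "norm (p n) \<le> K * L * (R + S) ^ n" by linarith
qed

section \<open>Convergence of umbral binomial series\<close>

text \<open>
  Successive ratios \<open>(b + n) / (c + n)\<close> tend to \<open>1\<close>, so the quotient grows more slowly than any
  geometric sequence with ratio above \<open>1\<close>.
\<close>
lemma pochhammer_ratio_growth:
  fixes b c :: complex
  assumes c: "\<And>n. c \<noteq> - of_nat n" and "\<rho> > 1"
  obtains K where "\<And>n. norm (pochhammer b n / pochhammer c n) \<le> K * \<rho> ^ n"
proof -
  define q where "q = (\<lambda>n. norm (pochhammer b n / pochhammer c n))"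
  have "(\<lambda>n. norm ((b + of_nat n) / (c + of_nat n))) \<longlonglongrightarrow> norm (1::complex)"
  proof (intro tendsto_norm)
    have nz: "c + of_nat n \<noteq> 0" for n using c[of n] by (simp add: eq_neg_iff_add_eq_0)
    have "filterlim (\<lambda>n. c + of_nat n) at_infinity sequentially"
      by (intro tendsto_add_filterlim_at_infinity[OF tendsto_const] tendsto_of_nat)
    then have "(\<lambda>n. 1 + (b - c) / (c + of_nat n)) \<longlonglongrightarrow> 1 + 0"
      by (intro tendsto_add tendsto_const tendsto_divide_0[OF tendsto_const])
    moreover have "1 + (b - c) / (c + of_nat n) = (b + of_nat n) / (c + of_nat n)" for n
      using nz[of n] by (simp add: field_simps)
    ultimately show "(\<lambda>n. (b + of_nat n) / (c + of_nat n)) \<longlonglongrightarrow> 1" by simp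
  qed
  then have "eventually (\<lambda>n. norm ((b + of_nat n) / (c + of_nat n)) < \<rho>) sequentially"
    using \<open>\<rho> > 1\<close> by (intro order_tendstoD) auto
  then obtain N where N: "\<And>n. n \<ge> N \<Longrightarrow> norm ((b + of_nat n) / (c + of_nat n)) < \<rho>"
    by (auto simp: eventually_sequentially)
  define K where "K = (\<Sum>i\<le>N. q i)"
  have q0: "q n \<ge> 0" for n by (simp add: q_def)
  have K0: "K \<ge> 0" unfolding K_def by (intro sum_nonneg q0)
  have small: "q n \<le> K * \<rho> ^ n" if "n \<le> N" for n
  proof -
    have "q n \<le> K" unfolding K_def using that by (intro member_le_sum) (auto simp: q0)
    also have "K * 1 \<le> K * \<rho> ^ n" using K0 \<open>\<rho> > 1\<close> by (intro mult_left_mono one_le_power) auto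
    finally show ?thesis by simp
  qed
  have "q n \<le> K * \<rho> ^ n" if "N \<le> n" for n
    using that
  proof (induction n rule: dec_induct)
    case base
    show ?case by (rule small) simp
  next
    case (step n)
    have "q (Suc n) = q n * norm ((b + of_nat n) / (c + of_nat n))"
      by (simp add: q_def pochhammer_Suc norm_mult norm_divide)
    also have "\<dots> \<le> (K * \<rho> ^ n) * \<rho>"
      using step.IH N[OF step.hyps(1)] K0 \<open>\<rho> > 1\<close> q0 by (intro mult_mono) auto
    finally show ?case by (simp add: mult_ac)
  qed
  with small have "norm (pochhammer b n / pochhammer c n) \<le> K * \<rho> ^ n" for n
    using nat_le_linear[of n N] unfolding q_def by blast
  then show ?thesis by (rule that)
qed

lemma umbral_abs_summable:
  fixes a :: complex and p :: "nat \<Rightarrow> complex"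
  assumes p: "\<And>n. norm (p n) \<le> K * r ^ n" and r: "0 \<le> r" "r < 1"
  shows "summable (\<lambda>n. norm (pochhammer a n / fact n * p n))"
proof -
  obtain \<rho> where \<rho>: "\<rho> > 1" "\<rho> * r < 1"
  proof (cases "r = 0")
    case True then show ?thesis using that[of 2] by simp
  next
    case False
    with r have "1 < 1 / r" by simp
    then obtain \<rho> where "1 < \<rho>" "\<rho> < 1 / r" using dense by blast
    then show ?thesis using that[of \<rho>] r False by (simp add: field_simps)
  qed
  \<comment> \<open>Since \<open>n! = (1)\<^sub>n\<close>, the binomial coefficients are themselves Pochhammer ratios.\<close>
  have "1 \<noteq> - (of_nat n :: complex)" for n
    using of_nat_neq_0[of n, where 'a = complex] by (metis add.inverse_inverse add.right_inverse of_nat_Suc)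
  then obtain M where M: "\<And>n. norm (pochhammer a n / pochhammer 1 n) \<le> M * \<rho> ^ n"
    using pochhammer_ratio_growth[of 1 \<rho> a] \<rho>(1) by metis
  have K: "K \<ge> 0" using order_trans[OF norm_ge_zero p[of 0]] by simp
  have bound: "norm (pochhammer a n / fact n * p n) \<le> M * K * (\<rho> * r) ^ n" for n
  proof -
    have "norm (pochhammer a n / fact n * p n) \<le> (M * \<rho> ^ n) * (K * r ^ n)"
      unfolding norm_mult using M[of n] p[of n] 
      by (intro mult_mono) (auto simp: pochhammer_fact intro: order_trans[OF norm_ge_zero])
    then show ?thesis by (simp add: power_mult_distrib mult_ac)
  qed
  have "summable (\<lambda>n. M * K * (\<rho> * r) ^ n)"
    using \<rho> r by (intro summable_mult summable_geometric) auto
  then show ?thesis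
    by (rule summable_comparison_test'[where N = 0]) (use bound in simp)
qed

text \<open>
  Grouping the absolutely convergent double series by \<open>N = m + n\<close> turns the product
  \<open>u\<^sub>m v\<^sub>n / (m! n!)\<close> into the binomial convolution.
\<close>
lemma umbral_product:
  fixes a :: complex and u v p :: "nat \<Rightarrow> complex"
  assumes p: "egf p = egf u * egf v"
    and u: "\<And>n. norm (u n) \<le> K * R ^ n" and v: "\<And>n. norm (v n) \<le> L * S ^ n"
    and RS: "R \<ge> 0" "S \<ge> 0" "R + S < 1"
  defines "f \<equiv> \<lambda>(m, n). pochhammer a (m + n) * (u m / fact m) * (v n / fact n)"
  shows "(\<lambda>x. norm (f x)) summable_on UNIV" and "infsum f UNIV = umbral a p"
proof -
  define g where "g = (\<lambda>(N::nat, m::nat). (m, N - m))"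
  have bij: "bij_betw g (SIGMA N:UNIV. {..N}) UNIV"
    by (rule bij_betwI[of _ _ _ "\<lambda>(m, n). (m + n, m)"]) (auto simp: g_def)
  define c where "c = (\<lambda>N. \<Sum>m\<le>N. norm (f (g (N, m))))"
  have c: "c N = norm (pochhammer a N / fact N *
      of_real (\<Sum>m\<le>N. of_nat (N choose m) * norm (u m) * norm (v (N - m))))" for N
  proof -
    have "c N = (\<Sum>m\<le>N. norm (pochhammer a N) / fact N * 
        (of_nat (N choose m) * norm (u m) * norm (v (N - m))))"
      unfolding c_def f_def g_def
      by (intro sum.cong refl) (simp add: norm_mult norm_divide binomial_fact field_simps)
    also have "\<dots> = norm (pochhammer a N / fact N) *
        \<bar>\<Sum>m\<le>N. of_nat (N choose m) * norm (u m) * norm (v (N - m))\<bar>"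
      by (subst abs_of_nonneg) (auto intro!: sum_nonneg simp: sum_distrib_left norm_divide)
    finally show ?thesis by (simp only: norm_mult norm_of_real)
  qed
  have "summable c"
    unfolding c
  proof (rule umbral_abs_summable)
    show "norm (complex_of_real (\<Sum>m\<le>N. of_nat (N choose m) * norm (u m) * norm (v (N - m))))
        \<le> K * L * (R + S) ^ N" for N
      unfolding norm_of_real using egf_mult_growth(1)[OF p u v RS(1,2), of N]
      by (subst abs_of_nonneg) (auto intro!: sum_nonneg)
  qed (use RS in auto)
  then have "c summable_on UNIV"
    by (subst summable_on_UNIV_nonneg_real_iff) (auto simp: c_def intro!: sum_nonneg)
  then have "(\<lambda>x. norm (f (g x))) summable_on (SIGMA N:UNIV. {..N})"
    by (intro summable_on_SigmaI[where g = c]) (auto simp: c_def intro!: has_sum_finite)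
  then show abs: "(\<lambda>x. norm (f x)) summable_on UNIV"
    by (subst (asm) summable_on_reindex_bij_betw[OF bij, of "\<lambda>x. norm (f x)"])
  then have "(f has_sum infsum f UNIV) UNIV"
    by (rule has_sum_infsum[OF Infinite_Sum.abs_summable_summable])
  then have "((\<lambda>x. f (g x)) has_sum infsum f UNIV) (SIGMA N:UNIV. {..N})"
    by (subst has_sum_reindex_bij_betw[OF bij, of f])
  then have "((\<lambda>N. \<Sum>m\<le>N. f (g (N, m))) has_sum infsum f UNIV) UNIV"
    by (rule has_sum_SigmaD) (auto intro!: has_sum_finite)
  moreover have "(\<Sum>m\<le>N. f (g (N, m))) = pochhammer a N / fact N * p N" for N
    unfolding egf_mult_nth(2)[OF p] f_def g_def sum_distrib_left
    by (intro sum.cong refl) (simp add: binomial_fact field_simps)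
  ultimately have "(\<lambda>N. pochhammer a N / fact N * p N) sums infsum f UNIV"
    by (intro has_sum_imp_sums) simp
  then show "infsum f UNIV = umbral a p"
    by (simp add: umbral_def sums_iff)
qed

section \<open>The umbral shift\<close>

lemma negative_binomial_sums:
  fixes a z :: complex
  assumes "norm z < 1"
  shows "(\<lambda>n. pochhammer (a + of_nat j) n * (z ^ n / fact n)) sums
    ((1 - z) powr (- a) / (1 - z) ^ j)"
proof -
  have "1 - z \<noteq> 0" using assms by auto
  then have "(1 - z) powr (- (a + of_nat j)) = (1 - z) powr (- a) / (1 - z) ^ j"
    by (simp add: powr_diff powr_nat)
  moreover have "(\<lambda>n. (- (a + of_nat j) gchoose n) * (- z) ^ n) sums
      (1 + - z) powr (- (a + of_nat j))"
    using assms by (intro gen_binomial_complex) simp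
  moreover have "(- (a + of_nat j) gchoose n) * (- z) ^ n =
      pochhammer (a + of_nat j) n * (z ^ n / fact n)" for n
  proof -
    have "(- (a + of_nat j) gchoose n) * (- z) ^ n =
        ((- 1) ^ n * (- 1) ^ n) * (pochhammer (a + of_nat j) n * (z ^ n / fact n))"
      unfolding gbinomial_pochhammer power_minus[of z] minus_minus by simp
    then show ?thesis by (simp flip: power_mult_distrib)
  qed
  ultimately show ?thesis by simp
qed

text \<open>
  When \<open>r + \<bar>z\<bar> < 1\<close> the double series of \<open>(1 - (q + z))\<^bsup>-a\<^esup>\<close> converges absolutely. Summing it along
  antidiagonals gives the left-hand side; summing first over the exponent of \<open>z\<close>, by
  \<open>\<Sum>\<^sub>n (a + m)\<^sub>n z\<^sup>n / n! = (1 - z)\<^bsup>-a-m\<^esup>\<close>, gives the right-hand side.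
\<close>
lemma umbral_shift_small:
  assumes p: "egf p = egf q * egf (\<lambda>n. z ^ n)"
    and q: "\<And>n. norm (q n) \<le> K * r ^ n"
    and r: "0 \<le> r" "r + norm z < 1"
  shows "umbral a p = (1 - z) powr (- a) * umbral a (\<lambda>n. q n / (1 - z) ^ n)"
proof -
  define f where "f = (\<lambda>(m, n). pochhammer a (m + n) * (q m / fact m) * (z ^ n / fact n))"
  have *: "norm (z ^ n) \<le> 1 * norm z ^ n" for n by (simp add: norm_power)
  note prod = umbral_product[OF p q * r(1) norm_ge_zero r(2), of a, folded f_def]
  have sum: "(f has_sum umbral a p) (UNIV \<times> UNIV)"
    using Infinite_Sum.abs_summable_summable[OF prod(1)] prod(2) by (metis has_sum_infsum UNIV_Times_UNIV)
  have z1: "norm z < 1" using r by linarith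
  have inner: "((\<lambda>n. f (m, n)) has_sum 
      (1 - z) powr (- a) * (pochhammer a m / fact m * (q m / (1 - z) ^ m))) UNIV" for m
  proof -
    have "(\<lambda>n. f (m, n)) summable_on UNIV"
      using summable_on_SigmaD1[of "\<lambda>m n. f (m, n)" UNIV "\<lambda>_. UNIV" m] has_sum_imp_summable[OF sum] by simp
    then have 1: "((\<lambda>n. f (m, n)) has_sum infsum (\<lambda>n. f (m, n)) UNIV) UNIV"
      by (rule has_sum_infsum)
    have "(\<lambda>n. f (m, n)) sums (pochhammer a m * (q m / fact m) * ((1 - z) powr (- a) / (1 - z) ^ m))"
      using sums_mult[OF negative_binomial_sums[OF z1, of a m], of "pochhammer a m * (q m / fact m)"]
      by (simp add: f_def pochhammer_product' mult_ac)
    with has_sum_imp_sums[OF 1] have "infsum (\<lambda>n. f (m, n)) UNIV =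
        pochhammer a m * (q m / fact m) * ((1 - z) powr (- a) / (1 - z) ^ m)"
      by (rule sums_unique2)
    with 1 show ?thesis by (simp add: mult_ac)
  qed
  have "((\<lambda>m. (1 - z) powr (- a) * (pochhammer a m / fact m * (q m / (1 - z) ^ m)))
      has_sum umbral a p) UNIV"
    using has_sum_SigmaD[OF sum, of "\<lambda>m. (1 - z) powr (- a) * (pochhammer a m / fact m * (q m / (1 - z) ^ m))"] inner by blast
  then have 2: "(\<lambda>m. (1 - z) powr (- a) * (pochhammer a m / fact m * (q m / (1 - z) ^ m)))
      sums umbral a p"
    by (rule has_sum_imp_sums)
  have "1 - z \<noteq> 0" using z1 by auto
  then have "(\<lambda>m. pochhammer a m / fact m * (q m / (1 - z) ^ m)) sums
      (umbral a p / (1 - z) powr (- a))"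
    using sums_divide[OF 2, of "(1 - z) powr (- a)"] by simp
  with \<open>1 - z \<noteq> 0\<close> show ?thesis unfolding umbral_def by (simp add: sums_iff)
qed

lemma umbral_powers_holomorphic:
  assumes p: "\<And>n. norm (p n) \<le> K * r ^ n" and "r > 0"
  shows "(\<lambda>t. umbral a (\<lambda>n. p n * t ^ n)) holomorphic_on ball 0 (1 / r)"
proof (rule power_series_holomorphic)
  fix t :: complex assume "t \<in> ball 0 (1 / r)"
  then have t: "norm t * r < 1" using \<open>r > 0\<close> by (simp add: field_simps)
  have "summable (\<lambda>n. norm (pochhammer a n / fact n * (p n * t ^ n)))"
  proof (rule umbral_abs_summable)
    show "norm (p n * t ^ n) \<le> K * (norm t * r) ^ n" for n
      using mult_right_mono[OF p[of n], of "norm t ^ n"]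
      by (simp add: norm_mult norm_power power_mult_distrib mult_ac)
  qed (use t \<open>r > 0\<close> in auto)
  then show "(\<lambda>n. (pochhammer a n / fact n * p n) * (t - 0) ^ n) sums umbral a (\<lambda>n. p n * t ^ n)"
    using summable_sums[OF summable_norm_cancel] unfolding umbral_def by (simp add: mult.assoc)
qed

text \<open>
  This inequality is what makes the region of continuation star-shaped. The difference of the
  squares is \<open>(1 - l) (1 + l - 2 l Re w)\<close>, where both factors are nonnegative because
  \<open>Re w \<le> 1\<close>.
\<close>
lemma norm_one_minus_scale:
  fixes w :: complex
  assumes "norm w \<le> 1" "0 \<le> l" "l \<le> 1"
  shows "l * norm (1 - w) \<le> norm (1 - of_real l * w)"
proof -
  have "Re w \<le> 1" using assms(1) complex_Re_le_cmod[of w] by linarith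
  then have "l * Re w \<le> l * 1" using assms by (intro mult_left_mono)
  then have "0 \<le> (1 - l) * (1 + l - 2 * (l * Re w))" using assms by (intro mult_nonneg_nonneg) auto
  also have "\<dots> = (norm (1 - of_real l * w))\<^sup>2 - (l * norm (1 - w))\<^sup>2"
    unfolding power_mult_distrib cmod_power2 by (simp add: power2_eq_square algebra_simps)
  finally have "(l * norm (1 - w))\<^sup>2 \<le> (norm (1 - of_real l * w))\<^sup>2" by simp
  then show ?thesis by (rule power2_le_imp_le) simp
qed

text \<open>
  The general shift follows from the one for small arguments by analytic continuation in a
  common scaling factor \<open>t\<close> of \<open>p\<close>, \<open>q\<close> and \<open>z\<close>. The bound on \<open>p\<close> makes the left-hand side
  holomorphic for \<open>\<bar>t\<bar> r < 1\<close> and the bound on \<open>q\<close> makes the right-hand side holomorphic for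
  \<open>\<bar>t\<bar> r < \<bar>1 - t z\<bar>\<close>. The condition \<open>\<bar>t z\<bar> < 1\<close> keeps \<open>1 - t z\<close> off the branch cut of the
  principal power.
\<close>
lemma umbral_shift:
  assumes p: "\<And>n. norm (p n) \<le> K * r ^ n" and q: "\<And>n. norm (q n) \<le> L * r ^ n"
    and pq: "egf p = fps_exp z * egf q"
    and r: "0 < r" "r < 1" "r < norm (1 - z)" and z: "norm z < 1"
  shows "umbral a p = (1 - z) powr (- a) * umbral a (\<lambda>n. q n / (1 - z) ^ n)"
proof -
  define T where "T = {t. norm t * r < 1 \<and> norm (t * z) < 1 \<and> norm t * r < norm (1 - t * z)}"
  define F where "F = (\<lambda>t. umbral a (\<lambda>n. p n * t ^ n))"
  define H where "H = (\<lambda>t. umbral a (\<lambda>n. q n * t ^ n))"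
  define G where "G = (\<lambda>t. (1 - t * z) powr (- a) * H (t / (1 - t * z)))"
  define \<epsilon> where "\<epsilon> = 1 / (r + norm z)"
  have rz: "r + norm z > 0" using r by (simp add: add_pos_nonneg)
  have nz: "1 - t * z \<noteq> 0" if "t \<in> T" for t
    using that by (auto simp: T_def)
  have "open T"
    unfolding T_def by (intro open_Collect_conj open_Collect_less continuous_intros)
  have "starlike T"
    unfolding starlike_def
  proof (intro bexI[of _ 0] ballI subsetI)
    fix t s assume t: "t \<in> T" and "s \<in> closed_segment 0 t"
    then obtain l where l: "0 \<le> l" "l \<le> 1" and s: "s = of_real l * t"
      by (auto simp: in_segment scaleR_conv_of_real)
    have le: "norm s * c \<le> norm t * c" if "c \<ge> 0" for c
      using l that unfolding s by (intro mult_right_mono) (auto simp: norm_mult mult_left_le_one_le)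
    have "norm s * r < norm (1 - s * z)"
    proof (cases "l = 0")
      case False
      have "norm s * r = l * (norm t * r)" using l by (simp add: s norm_mult)
      also have "\<dots> < l * norm (1 - t * z)"
        using t l False by (intro mult_strict_left_mono) (auto simp: T_def)
      also have "\<dots> \<le> norm (1 - of_real l * (t * z))"
        using t l by (intro norm_one_minus_scale) (auto simp: T_def)
      finally show ?thesis by (simp add: s mult.assoc)
    qed (simp add: s)
    moreover have "norm s * r < 1"
      using t r by (intro order_le_less_trans[OF le[of r]]) (auto simp: T_def)
    moreover have "norm (s * z) < 1"
      using t unfolding norm_mult
      by (intro order_le_less_trans[OF le[of "norm z"]]) (auto simp: T_def norm_mult)
    ultimately show "s \<in> T" by (simp add: T_def)
  qed (simp add: T_def)
  then have "connected T" by (rule starlike_imp_connected)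
  have holF: "F holomorphic_on T"
    unfolding F_def
    by (rule holomorphic_on_subset[OF umbral_powers_holomorphic[OF p]])
       (use r in \<open>auto simp: T_def field_simps\<close>)
  have "H \<circ> (\<lambda>t. t / (1 - t * z)) holomorphic_on T"
  proof (rule holomorphic_on_compose_gen)
    show "(\<lambda>t. t / (1 - t * z)) holomorphic_on T" by (intro holomorphic_intros nz)
    show "H holomorphic_on ball 0 (1 / r)"
      unfolding H_def by (rule umbral_powers_holomorphic[OF q r(1)])
    show "(\<lambda>t. t / (1 - t * z)) ` T \<subseteq> ball 0 (1 / r)"
      using r nz by (auto simp: T_def norm_divide field_simps)
  qed
  moreover have "1 - t * z \<notin> \<real>\<^sub>\<le>\<^sub>0" if "t \<in> T" for t
  proof -
    have "Re (t * z) < 1" using that complex_Re_le_cmod[of "t * z"] by (auto simp: T_def)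
    then show ?thesis by (auto simp: complex_nonpos_Reals_iff)
  qed
  ultimately have holG: "G holomorphic_on T"
    unfolding G_def by (intro holomorphic_intros) (auto simp: o_def)
  have near_zero: "F t = G t" if "t \<in> ball 0 \<epsilon>" for t
  proof -
    have t: "norm t * r + norm (t * z) < 1"
      using that rz by (simp add: \<epsilon>_def norm_mult field_simps)
    have "F t = (1 - t * z) powr (- a) * umbral a (\<lambda>n. (q n * t ^ n) / (1 - t * z) ^ n)"
      unfolding F_def
    proof (rule umbral_shift_small)
      show "egf (\<lambda>n. p n * t ^ n) = egf (\<lambda>n. q n * t ^ n) * egf (\<lambda>n. (t * z) ^ n)"
        using egf_mult_scale[of p q "\<lambda>n. z ^ n" t] pq
        by (simp add: egf_powers mult.commute[of "fps_exp z"] power_mult_distrib mult.commute[of _ z])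
      show "norm (q n * t ^ n) \<le> L * (norm t * r) ^ n" for n
        using mult_right_mono[OF q[of n], of "norm t ^ n"]
        by (simp add: norm_mult norm_power power_mult_distrib mult_ac)
    qed (use t r in auto)
    then show ?thesis by (simp add: G_def H_def power_divide)
  qed
  have sub: "ball 0 \<epsilon> \<subseteq> T"
  proof
    fix t :: complex assume "t \<in> ball 0 \<epsilon>"
    then have "norm t * r + norm (t * z) < 1"
      using rz by (simp add: \<epsilon>_def norm_mult field_simps)
    moreover have "1 - norm (t * z) \<le> norm (1 - t * z)"
      using norm_triangle_ineq2[of 1 "t * z"] by simp
    moreover have "norm t * r \<ge> 0" using r by simp
    ultimately show "t \<in> T" using norm_ge_zero[of "t * z"] unfolding T_def mem_Collect_eq by linarith
  qed
  have "ball (0::complex) \<epsilon> \<noteq> {}" using rz by (simp add: \<epsilon>_def)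
  moreover have "1 \<in> T" using r z by (simp add: T_def)
  ultimately have "F 1 = G 1"
    using analytic_continuation_open[OF open_ball \<open>open T\<close> _ \<open>connected T\<close> sub holF holG near_zero] by blast
  then show ?thesis by (simp add: F_def G_def H_def power_divide)
qed

section \<open>Kummer's first transformation\<close>

text \<open>
  The exponential generating function of this sequence is the confluent hypergeometric series
  \<open>\<^sub>1F\<^sub>1(b; c; x t)\<close>.
\<close>
definition kummer :: "complex \<Rightarrow> complex \<Rightarrow> complex \<Rightarrow> nat \<Rightarrow> complex" where
  "kummer b c x n = pochhammer b n / pochhammer c n * x ^ n"

text \<open>
  Comparing coefficients leaves
  \<open>(b)\<^sub>n / (c)\<^sub>n = \<Sum>\<^sub>k (- 1)\<^sup>k (n choose k) (c - b)\<^sub>k / (c)\<^sub>k\<close>, the Chu-Vandermonde identity for the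
  parameter \<open>c - b\<close>.
\<close>
lemma egf_kummer_transformation:
  fixes b c x :: complex
  assumes c: "\<And>n. c \<noteq> - of_nat n"
  shows "egf (kummer b c x) = fps_exp x * egf (kummer (c - b) c (- x))"
proof (rule fps_ext)
  fix n
  have "fps_nth (egf (kummer b c x)) n =
      x ^ n / fact n * (pochhammer (c - (c - b)) n / pochhammer c n)"
    by (simp add: egf_def kummer_def mult.commute)
  also have "pochhammer (c - (c - b)) n / pochhammer c n = (\<Sum>k\<le>n.
      (pochhammer (c - b) k * pochhammer (- of_nat n) k) / (fact k * pochhammer c k))"
    using Vandermonde_pochhammer[of n c "c - b"] c by (simp add: atLeast0AtMost)
  also have "x ^ n / fact n * \<dots> = (\<Sum>k\<le>n. 
      (pochhammer (c - b) k / pochhammer c k * (- x) ^ k / fact k) * (x ^ (n - k) / fact (n - k)))"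
    unfolding sum_distrib_left
  proof (intro sum.cong refl)
    fix k assume "k \<in> {..n}"
    then have k: "k \<le> n" by simp
    have P: "pochhammer (- of_nat n) k = ((-1) ^ k * fact n / fact (n - k) :: complex)"
      using gbinomial_pochhammer[of "of_nat n :: complex" k] binomial_fact[OF k, where 'a = complex]
      by (simp add: binomial_gbinomial[symmetric] field_simps)
    have X: "x ^ n = x ^ k * x ^ (n - k)" using k by (simp flip: power_add)
    show "x ^ n / fact n * ((pochhammer (c - b) k * pochhammer (- of_nat n) k) / (fact k * pochhammer c k)) =
      (pochhammer (c - b) k / pochhammer c k * (- x) ^ k / fact k) * (x ^ (n - k) / fact (n - k))"
      unfolding P X power_minus[of x] by (simp add: mult_ac)
  qed
  also have "\<dots> = fps_nth (egf (kummer (c - b) c (- x)) * fps_exp x) n"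
    by (simp add: egf_def kummer_def fps_mult_nth atLeast0AtMost)
  finally show "fps_nth (egf (kummer b c x)) n =
    fps_nth (fps_exp x * egf (kummer (c - b) c (- x))) n"
    by (simp add: mult.commute)
qed

lemma kummer_growth:
  assumes c: "\<And>n. c \<noteq> - of_nat n" and r: "norm x < r"
  obtains K where "\<And>n. norm (kummer b c x n) \<le> K * r ^ n"
proof -
  obtain \<rho> where \<rho>: "\<rho> > 1" "\<rho> * norm x \<le> r"
    using that[of 2] that[of "r / norm x"] r by (cases "x = 0") (auto simp: field_simps)
  obtain K where K: "\<And>n. norm (pochhammer b n / pochhammer c n) \<le> K * \<rho> ^ n"
    using pochhammer_ratio_growth[OF c \<rho>(1)] by metis
  have K0: "K \<ge> 0" using order_trans[OF norm_ge_zero K[of 0]] by simp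
  have "norm (kummer b c x n) \<le> K * r ^ n" for n
  proof -
    have "norm (kummer b c x n) \<le> (K * \<rho> ^ n) * norm x ^ n"
      unfolding kummer_def norm_mult norm_power by (intro mult_right_mono K) simp
    also have "\<dots> = K * (\<rho> * norm x) ^ n" by (simp add: power_mult_distrib)
    also have "\<dots> \<le> K * r ^ n" using \<rho> K0 by (intro mult_left_mono power_mono) auto
    finally show ?thesis .
  qed
  then show ?thesis by (rule that)
qed

section \<open>Transformations of the second Appell function\<close>

text \<open>
  The second Appell function for \<open>k = 1\<close>, with the factors grouped as a product of two
  \<^const>\<open>kummer\<close> sequences.
\<close>
definition appell_F2 ::
  "complex \<Rightarrow> complex \<Rightarrow> complex \<Rightarrow> complex \<Rightarrow> complex \<Rightarrow> complex \<Rightarrow> complex \<Rightarrow> complex"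
where
  "appell_F2 a b b' c c' x y = (\<Sum>\<^sub>\<infinity>(m, n)\<in>UNIV.
     pochhammer a (m + n) * (kummer b c x m / fact m) * (kummer b' c' y n / fact n))"

text \<open>
  The bound on \<open>p\<close> holds for every \<open>r\<close> above \<open>\<bar>x\<bar> + \<bar>y\<bar>\<close>, including \<open>r \<ge> 1\<close>, where the double
  series need not converge.
\<close>
lemma appell_F2_umbral:
  assumes c: "\<And>n. c \<noteq> - of_nat n" "\<And>n. c' \<noteq> - of_nat n"
    and r: "norm x + norm y < r"
    and p: "egf p = egf (kummer b c x) * egf (kummer b' c' y)"
  obtains M where "\<And>n. norm (p n) \<le> M * r ^ n"
    and "r < 1 \<Longrightarrow> appell_F2 a b b' c c' x y = umbral a p"
proof -
  \<comment> \<open>The gap \<open>r - \<bar>x\<bar> - \<bar>y\<bar>\<close> is shared equally, so that \<open>\<bar>x\<bar> < R\<close>, \<open>\<bar>y\<bar> < S\<close> and \<open>R + S = r\<close>.\<close>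
  define R S where "R = (r + norm x - norm y) / 2" and "S = (r + norm y - norm x) / 2"
  have RS: "norm x < R" "norm y < S" "R + S = r" using r by (auto simp: R_def S_def field_simps)
  obtain K where K: "\<And>n. norm (kummer b c x n) \<le> K * R ^ n"
    using kummer_growth[OF c(1) RS(1)] by metis
  obtain L where L: "\<And>n. norm (kummer b' c' y n) \<le> L * S ^ n"
    using kummer_growth[OF c(2) RS(2)] by metis
  have pos: "R \<ge> 0" "S \<ge> 0"
    using RS norm_ge_zero[of x] norm_ge_zero[of y] by linarith+
  show ?thesis
  proof
    show "norm (p n) \<le> K * L * r ^ n" for n
      using egf_mult_growth(2)[OF p K L pos] RS by simp
    show "appell_F2 a b b' c c' x y = umbral a p" if "r < 1"
      unfolding appell_F2_def
      by (rule umbral_product(2)[OF p K L pos]) (use RS that in auto)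
  qed
qed

text \<open>
  The common form of the three transformations: \<open>x'\<close> and \<open>y'\<close> are \<open>x\<close> and \<open>y\<close> up to sign, and \<open>z\<close>
  is the exponent that Kummer's transformation has split off.
\<close>
lemma appell_F2_transformation:
  assumes c: "\<And>n. c \<noteq> - of_nat n" "\<And>n. c' \<noteq> - of_nat n"
    and xy: "norm x + norm y < 1" "norm x + norm y < norm (1 - z)" and z: "norm z < 1"
    and x': "norm x' = norm x" and y': "norm y' = norm y"
    and egf: "egf (kummer b c x) * egf (kummer b' c' y) =
      fps_exp z * (egf (kummer d c x') * egf (kummer d' c' y'))"
  shows "appell_F2 a b b' c c' x y =
    (1 - z) powr (- a) * appell_F2 a d d' c c' (x' / (1 - z)) (y' / (1 - z))"
proof -
  define p where "p = (\<lambda>n. fact n * fps_nth (egf (kummer b c x) * egf (kummer b' c' y)) n)"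
  define q where "q = (\<lambda>n. fact n * fps_nth (egf (kummer d c x') * egf (kummer d' c' y')) n)"
  have p: "egf p = egf (kummer b c x) * egf (kummer b' c' y)"
    by (rule fps_ext) (simp add: p_def egf_def[of "\<lambda>n. fact n * _ n"])
  have q: "egf q = egf (kummer d c x') * egf (kummer d' c' y')"
    by (rule fps_ext) (simp add: q_def egf_def[of "\<lambda>n. fact n * _ n"])
  \<comment> \<open>The strict inequalities leave room for a rate \<open>r\<close> strictly above \<open>\<bar>x\<bar> + \<bar>y\<bar>\<close>; this absorbs the
    subgeometric growth of the Pochhammer ratios.\<close>
  obtain r where r: "norm x + norm y < r" "r < 1" "r < norm (1 - z)"
    using dense[of "norm x + norm y" "min 1 (norm (1 - z))"] xy by auto
  then have r0: "r > 0" by (smt (verit) norm_ge_zero)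
  obtain K where K: "\<And>n. norm (p n) \<le> K * r ^ n"
      and F: "appell_F2 a b b' c c' x y = umbral a p"
    using appell_F2_umbral[OF c r(1) p] r(2) by metis
  obtain L where L: "\<And>n. norm (q n) \<le> L * r ^ n"
    using appell_F2_umbral[OF c _ q, of r] r(1) x' y' by metis
  have "(\<lambda>n. kummer d c x' n * inverse (1 - z) ^ n) = kummer d c (x' / (1 - z))"
       "(\<lambda>n. kummer d' c' y' n * inverse (1 - z) ^ n) = kummer d' c' (y' / (1 - z))"
    by (simp_all add: kummer_def fun_eq_iff power_divide power_inverse divide_inverse power_mult_distrib)
  with egf_mult_scale[OF q, of "inverse (1 - z)"]
  have q': "egf (\<lambda>n. q n / (1 - z) ^ n) =
      egf (kummer d c (x' / (1 - z))) * egf (kummer d' c' (y' / (1 - z)))"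
    by (simp add: divide_inverse power_inverse)
  have *: "norm (x' / (1 - z)) + norm (y' / (1 - z)) < r / norm (1 - z)"
    using divide_strict_right_mono[OF r(1), of "norm (1 - z)"] r r0
    by (cases "z = 1") (simp_all add: norm_divide x' y' add_divide_distrib)
  have "r / norm (1 - z) < 1" using r r0 by (cases "z = 1") simp_all
  then have G: "appell_F2 a d d' c c' (x' / (1 - z)) (y' / (1 - z)) =
      umbral a (\<lambda>n. q n / (1 - z) ^ n)"
    using appell_F2_umbral[OF c * q'] by metis
  have "umbral a p = (1 - z) powr (- a) * umbral a (\<lambda>n. q n / (1 - z) ^ n)"
    by (rule umbral_shift[OF K L _ r0 r(2,3) z]) (simp add: p q egf)
  then show ?thesis by (simp add: F G)
qed

lemma pochhammer_k_eq:
  assumes "k > 0"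
  shows "pochhammer_k k a n = of_real k ^ n * pochhammer (a / of_real k) n"
proof -
  have "pochhammer_k k a n = (\<Prod>i<n. of_real k * (a / of_real k + of_nat i))"
    using assms unfolding pochhammer_k_def by (intro prod.cong refl) (simp add: field_simps)
  then show ?thesis
    by (simp add: prod.distrib pochhammer_prod atLeast0LessThan)
qed

lemma appell_F2_k_rescale:
  assumes "k > 0"
  shows "appell_F2_k k \<alpha> \<beta> \<beta>' \<gamma> \<gamma>' x y =
    appell_F2 (\<alpha> / of_real k) (\<beta> / of_real k) (\<beta>' / of_real k) (\<gamma> / of_real k) (\<gamma>' / of_real k)
      (of_real k * x) (of_real k * y)"
  unfolding appell_F2_k_def appell_F2_def kummer_def pochhammer_k_eq[OF assms]
  using assms by (intro infsum_cong) (auto simp: power_add power_mult_distrib field_simps)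

theorem theorem12:
  fixes k :: real and \<alpha> \<beta> \<beta>' \<gamma> \<gamma>' x y :: complex
  assumes "k > 0"
    and "\<gamma> \<notin> range (\<lambda>j::nat. - (of_nat j * of_real k))"
    and "\<gamma>' \<notin> range (\<lambda>j::nat. - (of_nat j * of_real k))"
    and "norm x + norm y < 1 / k"
  shows "(norm (x / (1 - of_real k * x)) + norm (y / (1 - of_real k * x)) < 1 / k \<longrightarrow>
           appell_F2_k k \<alpha> \<beta> \<beta>' \<gamma> \<gamma>' x y =
             (1 - of_real k * x) powr (- (\<alpha> / of_real k)) *
             appell_F2_k k \<alpha> (\<gamma> - \<beta>) \<beta>' \<gamma> \<gamma>'
               (- (x / (1 - of_real k * x))) (y / (1 - of_real k * x)))
       \<and> (norm (x / (1 - of_real k * y)) + norm (y / (1 - of_real k * y)) < 1 / k \<longrightarrow>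
           appell_F2_k k \<alpha> \<beta> \<beta>' \<gamma> \<gamma>' x y =
             (1 - of_real k * y) powr (- (\<alpha> / of_real k)) *
             appell_F2_k k \<alpha> \<beta> (\<gamma>' - \<beta>') \<gamma> \<gamma>'
               (x / (1 - of_real k * y)) (- (y / (1 - of_real k * y))))
       \<and> (norm (x / (1 - of_real k * x - of_real k * y))
             + norm (y / (1 - of_real k * x - of_real k * y)) < 1 / k \<longrightarrow>
           appell_F2_k k \<alpha> \<beta> \<beta>' \<gamma> \<gamma>' x y =
             (1 - of_real k * x - of_real k * y) powr (- (\<alpha> / of_real k)) *
             appell_F2_k k \<alpha> (\<gamma> - \<beta>) (\<gamma>' - \<beta>') \<gamma> \<gamma>'
               (- (x / (1 - of_real k * x - of_real k * y)))
               (- (y / (1 - of_real k * x - of_real k * y))))"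
proof -
  define X Y a b b' c c' where defs: "X = of_real k * x" "Y = of_real k * y"
    "a = \<alpha> / of_real k" "b = \<beta> / of_real k" "b' = \<beta>' / of_real k"
    "c = \<gamma> / of_real k" "c' = \<gamma>' / of_real k"
  have k: "k > 0" by fact
  have c: "c \<noteq> - of_nat n" "c' \<noteq> - of_nat n" for n
    using assms(2,3) k unfolding defs by (auto simp: field_simps image_iff)
  have XY: "norm X + norm Y < 1"
    using assms(4) k by (simp add: defs norm_mult field_simps)
  have small: "norm X + norm Y < norm w" 
    if "norm (x / w) + norm (y / w) < 1 / k" "w \<noteq> 0" for w
    using that k by (simp add: defs norm_mult norm_divide field_simps)
  have nz: "1 - z \<noteq> 0" if "norm z < 1" for z :: complex using that by auto
  have Z: "norm X < 1" "norm Y < 1" "norm (X + Y) < 1"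
    using XY norm_ge_zero[of X] norm_ge_zero[of Y] norm_triangle_ineq[of X Y] by linarith+
  note K = egf_kummer_transformation[OF c(1), of b X] egf_kummer_transformation[OF c(2), of b' Y]
  note F = appell_F2_k_rescale[OF k]
  have 1: "appell_F2 a b b' c c' X Y =
      (1 - X) powr (- a) * appell_F2 a (c - b) b' c c' (- X / (1 - X)) (Y / (1 - X))"
    if "norm (x / (1 - X)) + norm (y / (1 - X)) < 1 / k"
    by (rule appell_F2_transformation[OF c XY small[OF that nz[OF Z(1)]] Z(1)]) (simp_all add: K(1) mult_ac)
  have 2: "appell_F2 a b b' c c' X Y =
      (1 - Y) powr (- a) * appell_F2 a b (c' - b') c c' (X / (1 - Y)) (- Y / (1 - Y))"
    if "norm (x / (1 - Y)) + norm (y / (1 - Y)) < 1 / k"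
    by (rule appell_F2_transformation[OF c XY small[OF that nz[OF Z(2)]] Z(2)]) (simp_all add: K(2) mult_ac)
  have 3: "appell_F2 a b b' c c' X Y = (1 - (X + Y)) powr (- a) *
      appell_F2 a (c - b) (c' - b') c c' (- X / (1 - (X + Y))) (- Y / (1 - (X + Y)))"
    if "norm (x / (1 - (X + Y))) + norm (y / (1 - (X + Y))) < 1 / k"
    by (rule appell_F2_transformation[OF c XY small[OF that nz[OF Z(3)]] Z(3)])
       (simp_all add: K fps_exp_add_mult mult_ac)
  show ?thesis
    using 1 2 3 unfolding F by (simp add: defs diff_divide_distrib diff_diff_eq)
qed

end
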